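(* Let $A_1,\dots,A_m\in\mathcal{S}_+^n$. Consider the problem (Fair PCA) $$\max_{z\in\mathbb{R}_+,\,X\in\mathcal{D}}\{z:\ z\le\langle A_i,X\rangle,\ \forall i\in[m]\},\qquad \mathcal{D}:=\{X\in\mathcal{S}_+^n:\ \operatorname{rank}(X)\le k,\ \|X\|_2\le1\},$$ and its relaxation (Fair PCA-R) $$V_{\rm rel}:=\max_{z\in\mathbb{R},\,X\in\operatorname{conv}(\mathcal{D})}\{z:\ z\le\langle A_i,X\rangle,\ \forall i\in[m]\},\qquad \operatorname{conv}(\mathcal{D})=\{X\in\mathcal{S}_+^n:\ \operatorname{tr}(X)\le k,\ \|X\|_2\le1\}.$$ Then there exists an optimal solution $(z,X)$ of Fair PCA-R such that $X$ has rank at most $k+\lfloor\sqrt{2m+1/4}-3/2\rfloor$. Moreover, if $m\le2$, then Fair PCA-R achieves the same optimal value as Fair PCA.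
   Context: $k\le n$ and $m$ are positive integers; $[m]=\{1,\dots,m\}$; $\mathcal{S}_+^n$ is the set of $n\times n$ real symmetric positive semidefinite matrices; $\langle\cdot,\cdot\rangle$ is the Frobenius inner product; $\|X\|_2$ is the spectral norm (largest singular value); $\operatorname{conv}$ denotes convex hull. The matrices $A_i$ are sample covariance matrices of $m$ groups. *)

theory Defs
  imports "HOL-Analysis.Analysis"
begin

text \<open>The inner product that \<^const>\<open>inner\<close> denotes on matrices is the Frobenius inner product.\<close>

lemma inner_matrix_eq_trace:
  fixes A B :: "real^'n^'n"
  shows "A \<bullet> B = trace (transpose A ** B)"
proof -
  have "A \<bullet> B = (\<Sum>i\<in>UNIV. \<Sum>j\<in>UNIV. A $ i $ j * B $ i $ j)"
    by (simp add: inner_vec_def)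
  also have "\<dots> = (\<Sum>j\<in>UNIV. \<Sum>i\<in>UNIV. A $ i $ j * B $ i $ j)"
    by (rule sum.swap)
  also have "\<dots> = trace (transpose A ** B)"
    by (simp add: trace_def matrix_matrix_mult_def transpose_def)
  finally show ?thesis .
qed

definition psd_matrices :: "(real^'n^'n) set" where
  "psd_matrices = {X. transpose X = X \<and> (\<forall>v. 0 \<le> v \<bullet> (X *v v))}"

definition singular_values :: "real^'n^'n \<Rightarrow> real set" where
  "singular_values X =
     {\<sigma>. 0 \<le> \<sigma> \<and> (\<exists>v. v \<noteq> 0 \<and> (transpose X ** X) *v v = \<sigma>\<^sup>2 *\<^sub>R v)}"

definition spectral_norm :: "real^'n^'n \<Rightarrow> real" where
  "spectral_norm X = Max (singular_values X)"

text \<open>The next lemmas show that this maximum is taken over a finite nonempty set, and that it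
  is the operator norm.\<close>

lemma inner_gram:
  fixes X :: "real^'n^'n"
  shows "w \<bullet> ((transpose X ** X) *v v) = (X *v w) \<bullet> (X *v v)"
  by (metis dot_lmul_matrix matrix_vector_mul_assoc transpose_matrix_vector inner_commute)

lemma finite_singular_values:
  fixes X :: "real^'n^'n"
  shows "finite (singular_values X)"
proof -
  define T where "T = transpose X ** X"
  have sym: "v \<bullet> (T *v w) = (T *v v) \<bullet> w" for v w
    unfolding T_def by (metis inner_gram inner_commute)
  have "\<forall>\<sigma>\<in>singular_values X. \<exists>v. v \<noteq> 0 \<and> T *v v = \<sigma>\<^sup>2 *\<^sub>R v"
    by (auto simp: singular_values_def T_def)
  then obtain e where e: "\<And>\<sigma>. \<sigma> \<in> singular_values X \<Longrightarrow> e \<sigma> \<noteq> 0 \<and> T *v e \<sigma> = \<sigma>\<^sup>2 *\<^sub>R e \<sigma>"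
    by metis
  have orth: "e s \<bullet> e t = 0"
    if "s \<in> singular_values X" "t \<in> singular_values X" "s \<noteq> t" for s t
  proof -
    have "t\<^sup>2 * (e s \<bullet> e t) = s\<^sup>2 * (e s \<bullet> e t)"
      using sym[of "e s" "e t"] e[OF that(1)] e[OF that(2)] by simp
    moreover have "s\<^sup>2 \<noteq> t\<^sup>2"
      using that by (auto simp: singular_values_def power2_eq_iff_nonneg)
    ultimately show ?thesis by simp
  qed
  have inj: "inj_on e (singular_values X)"
    by (rule inj_onI) (metis e orth inner_eq_zero_iff)
  have "pairwise orthogonal (e ` singular_values X)"
    by (auto simp: pairwise_def orthogonal_def intro!: orth)
  moreover have "0 \<notin> e ` singular_values X" using e by force
  ultimately have "finite (e ` singular_values X)"
    using pairwise_orthogonal_independent independent_imp_finite by blast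
  then show ?thesis using inj finite_image_iff by blast
qed

lemma singular_value_le_onorm:
  assumes "\<sigma> \<in> singular_values X"
  shows "\<sigma> \<le> onorm ((*v) X)"
proof -
  obtain v where v: "0 \<le> \<sigma>" "v \<noteq> 0" "(transpose X ** X) *v v = \<sigma>\<^sup>2 *\<^sub>R v"
    using assms by (auto simp: singular_values_def)
  have "(norm (X *v v))\<^sup>2 = (\<sigma> * norm v)\<^sup>2"
    using inner_gram[of v X v] v(3) by (simp add: power_mult_distrib power2_norm_eq_inner)
  then have "norm (X *v v) = \<sigma> * norm v"
    using v(1) by (simp add: power2_eq_iff_nonneg)
  then have "\<sigma> * norm v \<le> onorm ((*v) X) * norm v"
    using onorm[OF matrix_vector_mul_bounded_linear, of X v] by simp
  then show ?thesis using v(2) by simp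
qed

lemma onorm_in_singular_values:
  fixes X :: "real^'n^'n"
  shows "onorm ((*v) X) \<in> singular_values X"
proof -
  define M where "M = onorm ((*v) X)"
  have bnd: "norm (X *v v) \<le> M * norm v" for v
    unfolding M_def by (rule onorm[OF matrix_vector_mul_bounded_linear])
  have M0: "0 \<le> M"
    unfolding M_def by (rule onorm_pos_le[OF matrix_vector_mul_bounded_linear])
  obtain u :: "real^'n" where u: "norm u = 1"
    and umax: "\<And>v. norm v = 1 \<Longrightarrow> norm (X *v v) \<le> norm (X *v u)"
  proof -
    have "compact (sphere (0::real^'n) 1)" by simp
    moreover have "sphere (0::real^'n) 1 \<noteq> {}" by simp
    moreover have "continuous_on (sphere 0 1) (\<lambda>v. norm (X *v v))"
      by (intro continuous_intros linear_continuous_on matrix_vector_mul_bounded_linear)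
    ultimately have "\<exists>u\<in>sphere 0 1. \<forall>v\<in>sphere 0 1. norm (X *v v) \<le> norm (X *v u)"
      by (rule continuous_attains_sup)
    then show ?thesis using that by auto
  qed
  have "M \<le> norm (X *v u)"
    unfolding M_def
  proof (rule onorm_bound)
    fix v
    show "norm (X *v v) \<le> norm (X *v u) * norm v"
    proof (cases "v = 0")
      case False
      have "norm (X *v (v /\<^sub>R norm v)) \<le> norm (X *v u)"
        using False by (intro umax) simp
      then show ?thesis
        using False by (simp add: matrix_vector_mult_scaleR divide_simps mult.commute)
    qed simp
  qed simp
  then have Mu: "norm (X *v u) = M" using bnd[of u] u by simp
  define w where "w = (transpose X ** X) *v u"
  have "(norm w)\<^sup>2 = (X *v w) \<bullet> (X *v u)"
    unfolding power2_norm_eq_inner using inner_gram[of w X u] by (simp add: w_def)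
  also have "\<dots> \<le> norm (X *v w) * norm (X *v u)"
    by (rule norm_cauchy_schwarz)
  also have "\<dots> \<le> (M * norm w) * M"
    using Mu M0 bnd[of w] by (simp add: mult_right_mono)
  finally have "norm w * norm w \<le> M\<^sup>2 * norm w"
    by (simp add: power2_eq_square mult_ac)
  then have "norm w \<le> M\<^sup>2"
    by (cases "norm w = 0") auto
  then have "(norm w)\<^sup>2 \<le> (M\<^sup>2)\<^sup>2" by (intro power_mono) auto
  moreover have "u \<bullet> w = M\<^sup>2"
    using inner_gram[of u X u] Mu by (simp add: w_def flip: power2_norm_eq_inner)
  moreover have "(norm (w - M\<^sup>2 *\<^sub>R u))\<^sup>2 = (norm w)\<^sup>2 - 2 * M\<^sup>2 * (u \<bullet> w) + (M\<^sup>2)\<^sup>2 * (norm u)\<^sup>2"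
    unfolding power2_norm_eq_inner
    by (simp add: inner_diff_left inner_diff_right inner_commute[of w u] power2_eq_square algebra_simps)
  ultimately have "(norm (w - M\<^sup>2 *\<^sub>R u))\<^sup>2 \<le> 0"
    using u by (simp add: power2_eq_square)
  then have "w = M\<^sup>2 *\<^sub>R u" by simp
  moreover have "u \<noteq> 0" using u by auto
  ultimately show ?thesis
    using M0 unfolding singular_values_def M_def w_def by blast
qed

lemma spectral_norm_eq_onorm: "spectral_norm X = onorm ((*v) X)"
  unfolding spectral_norm_def
  by (intro Max_eqI finite_singular_values singular_value_le_onorm onorm_in_singular_values)

definition fair_pca_domain :: "nat \<Rightarrow> (real^'n^'n) set" where
  "fair_pca_domain k = {X \<in> psd_matrices. rank X \<le> k \<and> spectral_norm X \<le> 1}"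

text \<open>The two optimization problems are represented by their feasible sets of pairs \<open>(z, X)\<close>;
  in both of them the objective to be maximized is \<open>z\<close>.\<close>

definition fair_pca :: "nat \<Rightarrow> nat \<Rightarrow> (nat \<Rightarrow> real^'n^'n) \<Rightarrow> (real \<times> (real^'n^'n)) set" where
  "fair_pca k m A =
     {(z, X). 0 \<le> z \<and> X \<in> fair_pca_domain k \<and> (\<forall>i\<in>{1..m}. z \<le> A i \<bullet> X)}"

definition fair_pca_relaxed ::
    "nat \<Rightarrow> nat \<Rightarrow> (nat \<Rightarrow> real^'n^'n) \<Rightarrow> (real \<times> (real^'n^'n)) set" where
  "fair_pca_relaxed k m A =
     {(z, X). X \<in> convex hull (fair_pca_domain k) \<and> (\<forall>i\<in>{1..m}. z \<le> A i \<bullet> X)}"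

definition optimal_solution :: "(real \<times> 'a) set \<Rightarrow> real \<times> 'a \<Rightarrow> bool" where
  "optimal_solution F p \<longleftrightarrow> p \<in> F \<and> (\<forall>q\<in>F. fst q \<le> fst p)"

text \<open>The maximum has to be attained; a supremum that is not attained is not an optimal value.\<close>

definition optimal_value :: "(real \<times> 'a) set \<Rightarrow> real \<Rightarrow> bool" where
  "optimal_value F v \<longleftrightarrow> (\<exists>X. optimal_solution F (v, X))"

end

theory Submission
  imports Defs
begin

text \<open>
  Write \<open>\<C>\<close> for the set of symmetric \<open>X\<close> with \<open>0 \<preceq> X \<preceq> 1\<close> and \<open>tr X \<le> k\<close> (the fantope). Everything
  rests on one perturbation argument. Split the space orthogonally into the eigenspace \<open>F\<close> of
  \<open>X \<in> \<C>\<close> for the eigenvalue 1, the kernel \<open>K\<close>, and the rest \<open>R\<close>, of dimension \<open>r\<close>, on which the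
  eigenvalues of \<open>X\<close> lie strictly between 0 and 1. A symmetric matrix \<open>D\<close> that vanishes on \<open>F\<close> and
  \<open>K\<close> acts only on \<open>R\<close>, so \<open>X \<plusminus> D\<close> still satisfies both semidefinite constraints when \<open>D\<close> is small
  (\<open>psd_perturbation\<close>). These \<open>D\<close> form a space of dimension at least \<open>r(r + 1)/2\<close>
  (\<open>dim_symmetric_vanishing\<close>), hence if \<open>r(r + 1)/2\<close> exceeds the number of linear conditions that are
  to be preserved, the trace among them, then \<open>X\<close> can be moved in two opposite directions. On the
  other hand \<open>tr X\<close> is \<open>dim F\<close> plus the eigenvalues on \<open>R\<close>, so \<open>tr X \<le> k\<close> gives
  \<open>rank X = dim F + r \<le> k + r - 1\<close> as soon as \<open>r > 0\<close>. This dichotomy is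
  \<open>fantope_rank_or_perturbation\<close>.

  With the trace as the only condition, it shows that the extreme points of \<open>\<C>\<close> have rank at most
  \<open>k\<close>, and the Krein-Milman theorem turns this into \<open>conv \<D> = \<C>\<close>. For the rank bound, take an
  extreme point \<open>X\<close> of the set of all optimal \<open>X\<close> and impose the \<open>m\<close> conditions
  \<open>tr D = 0\<close> and \<open>\<langle>A\<^sub>i, D\<rangle> = \<langle>A\<^sub>1, D\<rangle>\<close> for \<open>i \<ge> 2\<close>. Moving along \<open>D\<close> changes all values
  \<open>\<langle>A\<^sub>i, X\<rangle>\<close> by the same amount, which must be 0 by optimality, so that the movement would stay
  within the optimal set and contradict extremality. Hence \<open>r(r + 1)/2 \<le> m\<close>, and solving for \<open>r\<close>
  gives the stated bound. For \<open>m \<le> 2\<close> this forces \<open>r \<le> 1\<close>, so that the optimal \<open>X\<close> has rank at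
  most \<open>k\<close> and is feasible for the problem with the rank constraint.
\<close>

section \<open>Positive semidefinite matrices\<close>

lemma psd_matrices_iff:
  "X \<in> psd_matrices \<longleftrightarrow> transpose X = X \<and> (\<forall>v. 0 \<le> v \<bullet> (X *v v))"
  by (simp add: psd_matrices_def)

lemma symmetric_inner_mult:
  fixes X :: "real^'n^'n"
  assumes "transpose X = X"
  shows "v \<bullet> (X *v w) = (X *v v) \<bullet> w"
  by (metis assms dot_lmul_matrix transpose_matrix_vector inner_commute)

lemma transpose_add: "transpose (A + B) = transpose A + transpose (B :: real^'n^'m)"
  by (simp add: transpose_def vec_eq_iff)

lemma transpose_diff: "transpose (A - B) = transpose A - transpose (B :: real^'n^'m)"
  by (simp add: transpose_def vec_eq_iff)

lemma transpose_scaleR: "transpose (c *\<^sub>R B) = c *\<^sub>R transpose (B :: real^'n^'m)"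
  by (simp add: transpose_def vec_eq_iff)

lemma scaleR_matrix_vector_mult: "(c *\<^sub>R B) *v v = c *\<^sub>R (B *v v)" for B :: "real^'n^'m"
  by (simp add: matrix_vector_mult_def vec_eq_iff sum_distrib_left mult_ac)

lemma psd_matrices_add: "X \<in> psd_matrices \<Longrightarrow> Y \<in> psd_matrices \<Longrightarrow> X + Y \<in> psd_matrices"
  by (simp add: psd_matrices_iff transpose_add matrix_vector_mult_add_rdistrib inner_add_right)

lemma psd_matrices_scaleR: "X \<in> psd_matrices \<Longrightarrow> 0 \<le> c \<Longrightarrow> c *\<^sub>R X \<in> psd_matrices"
  by (simp add: psd_matrices_iff transpose_scaleR scaleR_matrix_vector_mult)

lemma closed_psd_matrices: "closed (psd_matrices :: (real^'n^'n) set)"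
proof -
  have eq: "psd_matrices = {X :: real^'n^'n. transpose X = X} \<inter> (\<Inter>v. {X. 0 \<le> v \<bullet> (X *v v)})"
    by (auto simp: psd_matrices_def)
  moreover have "closed {X :: real^'n^'n. transpose X = X}"
    unfolding transpose_def by (intro closed_Collect_eq continuous_intros)
  moreover have "closed {X :: real^'n^'n. 0 \<le> v \<bullet> (X *v v)}" for v
    unfolding matrix_vector_mult_def by (intro closed_Collect_le continuous_intros)
  ultimately show ?thesis
    unfolding eq by (intro closed_Int closed_INT) auto
qed

text \<open>A zero of the quadratic form of \<open>X\<close> is a minimum, so the gradient \<open>2 X v\<close> vanishes there; the
  proof restricts the form to the line through \<open>v\<close> in the direction \<open>X v\<close>.\<close>

lemma psd_kernel:
  fixes X :: "real^'n^'n"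
  assumes X: "X \<in> psd_matrices" and v: "v \<bullet> (X *v v) = 0"
  shows "X *v v = 0"
proof -
  define w where "w = X *v v"
  define a where "a = w \<bullet> w"
  define b where "b = w \<bullet> (X *v w)"
  have sym: "transpose X = X" and pos: "\<And>v. 0 \<le> v \<bullet> (X *v v)"
    using X by (auto simp: psd_matrices_iff)
  have b0: "0 \<le> b" unfolding b_def by (rule pos)
  have quad: "0 \<le> 2 * t * a + t\<^sup>2 * b" for t
  proof -
    have "v \<bullet> (X *v w) = a"
      using symmetric_inner_mult[OF sym, of v w] by (simp add: w_def a_def)
    moreover have "w \<bullet> (X *v v) = a" by (simp add: w_def a_def)
    ultimately have "(v + t *\<^sub>R w) \<bullet> (X *v (v + t *\<^sub>R w)) = 2 * t * a + t\<^sup>2 * b"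
      using v by (simp add: matrix_vector_right_distrib matrix_vector_mult_scaleR inner_add_left
          inner_add_right b_def power2_eq_square algebra_simps)
    then show ?thesis using pos[of "v + t *\<^sub>R w"] by simp
  qed
  have "a = 0"
  proof (cases "b = 0")
    case True
    then show ?thesis using quad[of "-1"] quad[of 1] by simp
  next
    case False
    then have b: "0 < b" using b0 by simp
    have "0 \<le> 2 * (- a / b) * a + (- a / b)\<^sup>2 * b" by (rule quad)
    also have "\<dots> = - (a\<^sup>2 / b)" using b by (simp add: power2_eq_square divide_simps)
    finally have "a\<^sup>2 / b \<le> 0" by simp
    then have "a\<^sup>2 \<le> 0" using b by (simp add: divide_le_0_iff)
    then show ?thesis by simp
  qed
  then show ?thesis by (simp add: a_def w_def)
qed

text \<open>On the orthogonal complement of its kernel, \<open>Y\<close> is positive definite, hence by compactness of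
  the unit sphere bounded below there by a positive multiple of the identity. A small multiple of
  \<open>D\<close> cannot compensate this, and on the kernel of \<open>Y\<close> it does nothing.\<close>

lemma psd_perturbation:
  fixes Y D :: "real^'n^'n"
  assumes Y: "Y \<in> psd_matrices" and D: "transpose D = D"
    and ker: "\<And>v. Y *v v = 0 \<Longrightarrow> D *v v = 0"
  obtains e where "0 < e" and "\<And>t. \<bar>t\<bar> \<le> e \<Longrightarrow> Y + t *\<^sub>R D \<in> psd_matrices"
proof -
  have symY: "transpose Y = Y" and pos: "\<And>v. 0 \<le> v \<bullet> (Y *v v)"
    using Y by (auto simp: psd_matrices_iff)
  define K where "K = {v. Y *v v = 0}"
  have subK: "subspace K"
    by (auto simp: K_def subspace_def matrix_vector_right_distrib matrix_vector_mult_scaleR)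
  define R where "R = {y. \<forall>x\<in>K. orthogonal x y}"
  have subR: "subspace R" unfolding R_def by (rule subspace_orthogonal_to_vectors)
  obtain d where d: "0 < d" "\<And>v. v \<in> R \<Longrightarrow> norm v = 1 \<Longrightarrow> d \<le> v \<bullet> (Y *v v)"
  proof (cases "sphere 0 1 \<inter> R = {}")
    case True
    then show ?thesis using that[of 1] by force
  next
    case False
    have "compact (sphere 0 1 \<inter> R)"
      by (intro compact_Int_closed closed_subspace subR) auto
    moreover have "continuous_on (sphere 0 1 \<inter> R) (\<lambda>v. v \<bullet> (Y *v v))"
      by (intro continuous_intros linear_continuous_on matrix_vector_mul_bounded_linear)
    ultimately have "\<exists>u\<in>sphere 0 1 \<inter> R. \<forall>v\<in>sphere 0 1 \<inter> R. u \<bullet> (Y *v u) \<le> v \<bullet> (Y *v v)"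
      using False by (intro continuous_attains_inf)
    then obtain u where u: "u \<in> sphere 0 1" "u \<in> R"
      "\<And>v. v \<in> sphere 0 1 \<inter> R \<Longrightarrow> u \<bullet> (Y *v u) \<le> v \<bullet> (Y *v v)" by blast
    have "u \<notin> K" using u by (auto simp: R_def orthogonal_def)
    then have "u \<bullet> (Y *v u) \<noteq> 0" using psd_kernel[OF Y] by (auto simp: K_def)
    then have "0 < u \<bullet> (Y *v u)" using pos[of u] by linarith
    then show ?thesis using that u(3) by simp
  qed
  have dR: "d * (v \<bullet> v) \<le> v \<bullet> (Y *v v)" if "v \<in> R" for v
  proof (cases "v = 0")
    case False
    have "d \<le> (v /\<^sub>R norm v) \<bullet> (Y *v (v /\<^sub>R norm v))"
      using False that subR by (intro d(2)) (auto simp: subspace_scale)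
    also have "\<dots> = (v \<bullet> (Y *v v)) / (norm v)\<^sup>2"
      by (simp add: matrix_vector_mult_scaleR power2_eq_square divide_simps)
    finally show ?thesis
      using False by (simp add: pos_le_divide_eq power2_norm_eq_inner)
  qed simp
  define N where "N = onorm ((*v) D)"
  have N0: "0 \<le> N"
    unfolding N_def by (rule onorm_pos_le[OF matrix_vector_mul_bounded_linear])
  have bnd: "\<bar>v \<bullet> (D *v v)\<bar> \<le> N * (v \<bullet> v)" for v
  proof -
    have "\<bar>v \<bullet> (D *v v)\<bar> \<le> norm v * norm (D *v v)" by (rule Cauchy_Schwarz_ineq2)
    also have "\<dots> \<le> norm v * (N * norm v)"
      unfolding N_def by (intro mult_left_mono onorm[OF matrix_vector_mul_bounded_linear]) simp
    finally show ?thesis by (simp add: norm_eq_sqrt_inner mult_ac)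
  qed
  show ?thesis
  proof (rule that)
    show "0 < d / (N + 1)" using d N0 by simp
    fix t :: real assume t: "\<bar>t\<bar> \<le> d / (N + 1)"
    have tN: "\<bar>t\<bar> * N \<le> d"
    proof -
      have "\<bar>t\<bar> * (N + 1) \<le> d" using t N0 by (simp add: pos_le_divide_eq)
      then show ?thesis by (simp add: distrib_left)
    qed
    have "0 \<le> v \<bullet> ((Y + t *\<^sub>R D) *v v)" for v
    proof -
      obtain y z where yz: "y \<in> span K" "\<And>w. w \<in> span K \<Longrightarrow> orthogonal z w" "v = y + z"
        using orthogonal_subspace_decomp_exists[of K v] by blast
      have yK: "y \<in> K" and zR: "z \<in> R"
        using yz subK by (auto simp: R_def span_eq_iff[THEN iffD2] orthogonal_commute)
      have Yy: "Y *v y = 0" using yK by (simp add: K_def)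
      have Dy: "D *v y = 0" using ker Yy by simp
      define M where "M = Y + t *\<^sub>R D"
      have symM: "transpose M = M" by (simp add: M_def transpose_add transpose_scaleR symY D)
      have My: "M *v y = 0"
        by (simp add: M_def matrix_vector_mult_add_rdistrib scaleR_matrix_vector_mult Yy Dy)
      have "y \<bullet> (M *v z) = 0" using symmetric_inner_mult[OF symM, of y z] My by simp
      then have "v \<bullet> (M *v v) = z \<bullet> (M *v z)"
        using My by (simp add: yz(3) matrix_vector_right_distrib inner_add_left)
      also have "\<dots> = z \<bullet> (Y *v z) + t * (z \<bullet> (D *v z))"
        by (simp add: M_def matrix_vector_mult_add_rdistrib scaleR_matrix_vector_mult inner_add_right)
      also have "\<dots> \<ge> 0"
      proof -
        have "\<bar>t * (z \<bullet> (D *v z))\<bar> \<le> \<bar>t\<bar> * (N * (z \<bullet> z))"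
          using bnd[of z] by (simp add: abs_mult mult_left_mono)
        also have "\<dots> \<le> d * (z \<bullet> z)"
          using mult_right_mono[OF tN, of "z \<bullet> z"] by (simp add: mult_ac)
        also have "\<dots> \<le> z \<bullet> (Y *v z)" using dR zR by simp
        finally show ?thesis by linarith
      qed
      finally show ?thesis by (simp add: M_def)
    qed
    then show "Y + t *\<^sub>R D \<in> psd_matrices"
      by (simp add: psd_matrices_iff transpose_add transpose_scaleR symY D)
  qed
qed

section \<open>Traces and orthonormal bases\<close>

lemma orthonormal_basis_expansion:
  fixes B :: "'a::euclidean_space set"
  assumes orth: "pairwise orthogonal B" and norm: "\<And>b. b \<in> B \<Longrightarrow> norm b = 1"
    and span: "span B = UNIV" and fin: "finite B"
  shows "(\<Sum>b\<in>B. (v \<bullet> b) *\<^sub>R b) = v"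
proof -
  define w where "w = v - (\<Sum>b\<in>B. (v \<bullet> b) *\<^sub>R b)"
  have "orthogonal w c" if c: "c \<in> B" for c
  proof -
    have "(\<Sum>b\<in>B. (v \<bullet> b) * (b \<bullet> c)) = (\<Sum>b\<in>B. if b = c then v \<bullet> c else 0)"
      using orth norm c
      by (intro sum.cong) (auto simp: pairwise_def orthogonal_def norm_eq_1)
    then show ?thesis
      using c fin by (simp add: w_def orthogonal_def inner_diff_left inner_sum_left)
  qed
  then have "orthogonal w w"
    using orthogonal_to_span[of w B w] span by auto
  then show ?thesis by (simp add: w_def orthogonal_def)
qed

lemma trace_orthonormal_basis:
  fixes X :: "real^'n^'n"
  assumes "pairwise orthogonal B" and "\<And>b. b \<in> B \<Longrightarrow> norm b = 1"
    and "span B = UNIV" and "finite B"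
  shows "trace X = (\<Sum>b\<in>B. b \<bullet> (X *v b))"
proof -
  have "(\<Sum>b\<in>B. b \<bullet> (X *v b)) = (\<Sum>i\<in>UNIV. \<Sum>b\<in>B. b $ i * (X *v b) $ i)"
    by (simp add: inner_vec_def sum.swap[of _ B])
  also have "\<dots> = (\<Sum>i\<in>UNIV. (X *v (\<Sum>b\<in>B. (axis i 1 \<bullet> b) *\<^sub>R b)) $ i)"
    by (simp add: linear_sum[OF matrix_vector_mul_linear] matrix_vector_mult_scaleR
        sum_component inner_axis')
  also have "\<dots> = (\<Sum>i\<in>UNIV. (X *v axis i 1) $ i)"
    by (simp only: orthonormal_basis_expansion[OF assms])
  also have "\<dots> = trace X"
    by (simp add: matrix_vector_mult_basis column_def trace_def)
  finally show ?thesis by simp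
qed

text \<open>This provides the bases in which traces are evaluated below. The subspaces are the
  eigenspaces of a symmetric matrix for two eigenvalues, or its range and the zero space.\<close>

lemma orthonormal_basis_of_decomposition:
  fixes S T :: "'a::euclidean_space set"
  assumes S: "subspace S" and T: "subspace T" and ST: "\<And>x y. x \<in> S \<Longrightarrow> y \<in> T \<Longrightarrow> orthogonal x y"
  defines "R \<equiv> {y. \<forall>x\<in>S \<union> T. orthogonal x y}"
  obtains BS BT BR where
    "BS \<subseteq> S" "BT \<subseteq> T" "BR \<subseteq> R" "card BS = dim S" "card BT = dim T" "card BR = dim R"
    "pairwise orthogonal (BS \<union> BT \<union> BR)" "\<forall>b\<in>BS \<union> BT \<union> BR. norm b = 1"
    "span (BS \<union> BT \<union> BR) = UNIV" "finite (BS \<union> BT \<union> BR)"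
    "BS \<inter> BT = {}" "(BS \<union> BT) \<inter> BR = {}"
    "dim S + dim T + dim R = DIM('a)"
proof -
  have R: "subspace R" unfolding R_def by (rule subspace_orthogonal_to_vectors)
  obtain BS where BS: "BS \<subseteq> S" "pairwise orthogonal BS" "\<And>x. x \<in> BS \<Longrightarrow> norm x = 1"
    "independent BS" "card BS = dim S" "span BS = S"
    using orthonormal_basis_subspace[OF S] by metis
  obtain BT where BT: "BT \<subseteq> T" "pairwise orthogonal BT" "\<And>x. x \<in> BT \<Longrightarrow> norm x = 1"
    "independent BT" "card BT = dim T" "span BT = T"
    using orthonormal_basis_subspace[OF T] by metis
  obtain BR where BR: "BR \<subseteq> R" "pairwise orthogonal BR" "\<And>x. x \<in> BR \<Longrightarrow> norm x = 1"
    "independent BR" "card BR = dim R" "span BR = R"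
    using orthonormal_basis_subspace[OF R] by metis
  let ?B = "BS \<union> BT \<union> BR"
  have fin: "finite BS" "finite BT" "finite BR"
    using BS(4) BT(4) BR(4) by (auto intro: independent_imp_finite)
  have oST: "orthogonal x y" if "x \<in> BS" "y \<in> BT" for x y
    using that BS(1) BT(1) ST by blast
  have oR: "orthogonal x y" if "x \<in> BS \<union> BT" "y \<in> BR" for x y
    using that BS(1) BT(1) BR(1) unfolding R_def by blast
  have norm: "norm b = 1" if "b \<in> ?B" for b
    using that BS(3) BT(3) BR(3) by blast
  have disj: "BS \<inter> BT = {}" "(BS \<union> BT) \<inter> BR = {}"
    using oST oR norm by (force simp: orthogonal_self)+
  have orth: "pairwise orthogonal ?B"
  proof -
    have "orthogonal y x" if "x \<in> BS" "y \<in> BT" for x y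
      using oST[OF that] by (simp add: orthogonal_commute)
    moreover have "orthogonal y x" if "x \<in> BS \<union> BT" "y \<in> BR" for x y
      using oR[OF that] by (simp add: orthogonal_commute)
    ultimately show ?thesis
      using BS(2) BT(2) BR(2) oST oR unfolding pairwise_def by blast
  qed
  have span: "span ?B = UNIV"
  proof -
    have "x \<in> span ?B" for x
    proof -
      obtain y z where yz: "y \<in> span (S \<union> T)" "\<And>w. w \<in> span (S \<union> T) \<Longrightarrow> orthogonal z w" "x = y + z"
        using orthogonal_subspace_decomp_exists[of "S \<union> T" x] by blast
      have "z \<in> R" using yz(2) by (auto simp: R_def orthogonal_commute span_base)
      then have "z \<in> span ?B" using BR(6) span_mono[of BR ?B] by blast
      moreover have "S \<union> T \<subseteq> span ?B"
        using BS(6) BT(6) span_mono[of BS ?B] span_mono[of BT ?B] by blast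
      then have "y \<in> span ?B" using yz(1) span_minimal[of "S \<union> T" "span ?B"] by auto
      ultimately show ?thesis by (simp add: yz(3) span_add)
    qed
    then show ?thesis by blast
  qed
  have "0 \<notin> ?B" using norm by force
  then have "independent ?B" using orth by (rule pairwise_orthogonal_independent[rotated])
  then have "card ?B = dim (UNIV :: 'a set)"
    using dim_eq_card_independent[of ?B] dim_span[of ?B] span by simp
  moreover have "card ?B = card BS + card BT + card BR"
  proof -
    have "card ?B = card (BS \<union> BT) + card BR"
      using fin disj(2) by (intro card_Un_disjoint) simp_all
    also have "card (BS \<union> BT) = card BS + card BT"
      using fin disj(1) by (intro card_Un_disjoint)
    finally show ?thesis .
  qed
  ultimately have dims: "dim S + dim T + dim R = DIM('a)"
    by (simp only: dim_UNIV BS(5) BT(5) BR(5))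
  have norms: "\<forall>b\<in>?B. norm b = 1" using norm by blast
  have finB: "finite ?B" using fin by simp
  show thesis
    by (rule that[OF BS(1) BT(1) BR(1) BS(5) BT(5) BR(5) orth norms span finB disj dims])
qed

section \<open>Symmetric matrices vanishing on a subspace\<close>

definition outer_product :: "real^'m \<Rightarrow> real^'n \<Rightarrow> real^'n^'m" where
  "outer_product u v = (\<chi> i j. u $ i * v $ j)"

lemma inner_outer_product: "outer_product a b \<bullet> outer_product c d = (a \<bullet> c) * (b \<bullet> d)"
proof -
  have "(a \<bullet> c) * (b \<bullet> d) = (\<Sum>i\<in>UNIV. \<Sum>j\<in>UNIV. (a $ i * c $ i) * (b $ j * d $ j))"
    by (simp add: inner_vec_def sum_product)
  then show ?thesis by (simp add: outer_product_def inner_vec_def mult_ac)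
qed

lemma outer_product_mult: "outer_product u v *v x = (v \<bullet> x) *\<^sub>R u"
  by (simp add: outer_product_def matrix_vector_mult_def inner_vec_def vec_eq_iff sum_distrib_left mult_ac)

lemma transpose_outer_product: "transpose (outer_product u v) = outer_product v u"
  by (simp add: outer_product_def transpose_def vec_eq_iff)

text \<open>For an orthonormal basis \<open>h\<close> of the orthogonal complement, the symmetrized outer products of
  \<open>h i\<close> and \<open>h j\<close> with \<open>i \<le> j\<close> are pairwise orthogonal, which gives their independence.\<close>

lemma dim_symmetric_vanishing:
  fixes S :: "(real^'n) set"
  defines "R \<equiv> {y. \<forall>x\<in>S. orthogonal x y}"
    and "W \<equiv> {D :: real^'n^'n. transpose D = D \<and> (\<forall>v\<in>S. D *v v = 0)}"
  shows "subspace W" and "dim R * (dim R + 1) \<le> 2 * dim W"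
proof -
  show subW: "subspace W"
    by (auto simp: W_def subspace_def transpose_add transpose_scaleR matrix_vector_mult_add_rdistrib
        scaleR_matrix_vector_mult transpose_def vec_eq_iff)
  define r where "r = dim R"
  have "subspace R" unfolding R_def by (rule subspace_orthogonal_to_vectors)
  then obtain B where B: "B \<subseteq> R" "pairwise orthogonal B" "\<And>x. x \<in> B \<Longrightarrow> norm x = 1"
    "independent B" "card B = r"
    using orthonormal_basis_subspace unfolding r_def by metis
  have "finite B" using B(4) by (rule independent_imp_finite)
  then obtain h where h: "bij_betw h {..<r} B"
    using B(5) ex_bij_betw_nat_finite[of B] by (auto simp: lessThan_atLeast0)
  have hB: "h i \<in> B" if "i < r" for i using h that by (auto simp: bij_betw_def)
  have hh: "h i \<bullet> h j = (if i = j then 1 else 0)" if "i < r" "j < r" for i j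
  proof (cases "i = j")
    case True
    then show ?thesis using B(3)[OF hB] that by (simp add: norm_eq_1)
  next
    case False
    then have "h i \<noteq> h j" using h that by (auto simp: bij_betw_def inj_on_def)
    then show ?thesis using False B(2) hB that by (auto simp: pairwise_def orthogonal_def)
  qed
  define I where "I = (SIGMA j:{..<r}. {..j})"
  define E where "E = (\<lambda>(j, i). outer_product (h i) (h j) + outer_product (h j) (h i))"
  have EE: "E p \<bullet> E q = 0 \<longleftrightarrow> p \<noteq> q" if "p \<in> I" "q \<in> I" for p q
    using that by (cases p; cases q)
      (auto simp: I_def E_def inner_add_left inner_add_right inner_outer_product hh)
  have inj: "inj_on E I"
    by (rule inj_onI) (metis EE)
  have EW: "E ` I \<subseteq> W"
  proof -
    have "h i \<bullet> v = 0" if "i < r" "v \<in> S" for i v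
      using hB[OF that(1)] B(1) that(2) by (auto simp: R_def orthogonal_def inner_commute)
    then show ?thesis
      by (auto simp: I_def E_def W_def transpose_add transpose_outer_product
          matrix_vector_mult_add_rdistrib outer_product_mult)
  qed
  have "pairwise orthogonal (E ` I)"
    unfolding pairwise_def orthogonal_def using EE by blast
  moreover have "0 \<notin> E ` I" using EE by force
  ultimately have "independent (E ` I)" by (rule pairwise_orthogonal_independent)
  then have "card (E ` I) \<le> dim W"
    using EW independent_card_le_dim by blast
  moreover have "2 * card I = r * (r + 1)"
  proof -
    have "card I = (\<Sum>j<r. Suc j)" by (simp add: I_def)
    moreover have "2 * (\<Sum>j<r. Suc j) = r * (r + 1)" for r :: nat by (induction r) auto
    ultimately show ?thesis by simp
  qed
  ultimately show "dim R * (dim R + 1) \<le> 2 * dim W"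
    by (simp add: card_image[OF inj] r_def)
qed

lemma subspace_contains_orthogonal_to_few:
  fixes W :: "'a::euclidean_space set"
  assumes W: "subspace W" and B: "finite B" "card B < dim W"
  obtains D where "D \<in> W" "D \<noteq> 0" "\<And>M. M \<in> B \<Longrightarrow> M \<bullet> D = 0"
proof -
  define U where "U = {y \<in> UNIV. \<forall>x\<in>span B. orthogonal x y}"
  have U: "subspace U" using subspace_orthogonal_to_vectors[of "span B"] by (simp add: U_def)
  have "dim U + dim (span B) = DIM('a)"
    unfolding U_def using dim_subspace_orthogonal_to_vectors[of "span B" UNIV] by simp
  moreover have "dim (span B) \<le> card B" using dim_le_card'[OF B(1)] by simp
  moreover have "dim {x + y |x y. x \<in> W \<and> y \<in> U} + dim (W \<inter> U) = dim W + dim U"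
    by (rule dim_sums_Int[OF W U])
  moreover have "dim {x + y |x y. x \<in> W \<and> y \<in> U} \<le> DIM('a)" by (rule dim_subset_UNIV)
  ultimately have "dim (W \<inter> U) \<noteq> 0" using B(2) by linarith
  then obtain D where "D \<in> W \<inter> U" "D \<noteq> 0" by (auto simp: dim_eq_0)
  then show ?thesis using that by (auto simp: U_def orthogonal_def span_base)
qed

section \<open>The fantope\<close>

definition fantope :: "nat \<Rightarrow> (real^'n^'n) set" where
  "fantope k = {X \<in> psd_matrices. mat 1 - X \<in> psd_matrices \<and> trace X \<le> real k}"

lemma inner_mat_1_left: "mat 1 \<bullet> X = trace (X :: real^'n^'n)"
  by (simp add: inner_matrix_eq_trace transpose_mat)

lemma psd_complement_iff:
  fixes X :: "real^'n^'n"
  assumes "X \<in> psd_matrices"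
  shows "mat 1 - X \<in> psd_matrices \<longleftrightarrow> (\<forall>v. v \<bullet> (X *v v) \<le> v \<bullet> v)"
  using assms
  by (simp add: psd_matrices_iff transpose_diff transpose_mat matrix_vector_mult_diff_rdistrib
      inner_diff_right)

lemma psd_spectral_norm_le_1_iff:
  fixes X :: "real^'n^'n"
  assumes X: "X \<in> psd_matrices"
  shows "spectral_norm X \<le> 1 \<longleftrightarrow> mat 1 - X \<in> psd_matrices"
proof -
  have sym: "transpose X = X" and pos: "\<And>v. 0 \<le> v \<bullet> (X *v v)"
    using X by (auto simp: psd_matrices_iff)
  have "v \<bullet> (X *v v) \<le> v \<bullet> v" if le: "spectral_norm X \<le> 1" for v
  proof -
    have "v \<bullet> (X *v v) \<le> norm v * norm (X *v v)" by (rule norm_cauchy_schwarz)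
    also have "norm (X *v v) \<le> onorm ((*v) X) * norm v"
      by (rule onorm[OF matrix_vector_mul_bounded_linear])
    also have "\<dots> \<le> 1 * norm v"
      using le by (intro mult_right_mono) (auto simp: spectral_norm_eq_onorm)
    finally show ?thesis by (simp add: mult_left_mono norm_eq_sqrt_inner)
  qed
  moreover have "spectral_norm X \<le> 1" if le: "\<And>v. v \<bullet> (X *v v) \<le> v \<bullet> v"
  proof -
    define s where "s = spectral_norm X"
    have "s \<in> singular_values X"
      by (simp add: s_def spectral_norm_eq_onorm onorm_in_singular_values)
    then obtain v where s0: "0 \<le> s" and v: "v \<noteq> 0" "X *v (X *v v) = s\<^sup>2 *\<^sub>R v"
      by (auto simp: singular_values_def sym matrix_vector_mul_assoc)
    define w where "w = X *v v + s *\<^sub>R v"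
    \<comment> \<open>As \<open>X\<^sup>2 - s\<^sup>2 = (X - s) (X + s)\<close>, this vector is zero or an eigenvector of \<open>X\<close> for \<open>s\<close>.\<close>
    have Xw: "X *v w = s *\<^sub>R w"
      by (simp add: w_def v(2) matrix_vector_right_distrib matrix_vector_mult_scaleR
          scaleR_add_right power2_eq_square)
    show ?thesis
    proof (cases "w = 0")
      case True
      then have "X *v v = - (s *\<^sub>R v)" by (simp add: w_def add_eq_0_iff2)
      then have "s * (v \<bullet> v) \<le> 0" using pos[of v] by simp
      moreover have "0 < v \<bullet> v" using v(1) by simp
      ultimately have "s \<le> 0" by (simp add: mult_le_0_iff)
      then show ?thesis by (simp add: s_def)
    next
      case False
      have "s * (w \<bullet> w) \<le> 1 * (w \<bullet> w)" using le[of w] by (simp add: Xw)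
      then show ?thesis using False by (simp add: s_def)
    qed
  qed
  ultimately show ?thesis using psd_complement_iff[OF X] by blast
qed

lemma fantope_eq:
  "{X. X \<in> psd_matrices \<and> trace X \<le> real k \<and> spectral_norm X \<le> 1} = fantope k"
  by (auto simp: fantope_def psd_spectral_norm_le_1_iff)

lemma convex_fantope: "convex (fantope k :: (real^'n^'n) set)"
proof (rule convexI)
  fix X Y :: "real^'n^'n" and u v :: real
  assume XY: "X \<in> fantope k" "Y \<in> fantope k" and uv: "0 \<le> u" "0 \<le> v" "u + v = 1"
  have "u *\<^sub>R mat 1 + v *\<^sub>R mat 1 = (mat 1 :: real^'n^'n)"
    using uv(3) by (simp flip: scaleR_add_left)
  then have "mat 1 - (u *\<^sub>R X + v *\<^sub>R Y) = u *\<^sub>R (mat 1 - X) + v *\<^sub>R (mat 1 - Y)"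
    by (simp add: scaleR_diff_right)
  moreover have "trace (u *\<^sub>R X + v *\<^sub>R Y) \<le> real k"
    using XY uv convex_bound_le[of "trace X" "real k" "trace Y" u v]
    by (simp add: fantope_def inner_add_right flip: inner_mat_1_left)
  ultimately show "u *\<^sub>R X + v *\<^sub>R Y \<in> fantope k"
    using XY uv by (simp add: fantope_def psd_matrices_add psd_matrices_scaleR)
qed

lemma compact_fantope: "compact (fantope k :: (real^'n^'n) set)"
proof -
  have eq: "fantope k = psd_matrices \<inter> ((\<lambda>X. mat 1 - X) -` psd_matrices)
      \<inter> {X :: real^'n^'n. mat 1 \<bullet> X \<le> real k}"
    by (auto simp: fantope_def inner_mat_1_left)
  have "closed (fantope k :: (real^'n^'n) set)"
    unfolding eq
    by (intro closed_Int closed_psd_matrices closed_vimage closed_halfspace_le continuous_intros)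
  moreover have "bounded (fantope k :: (real^'n^'n) set)"
  proof (rule boundedI)
    fix X :: "real^'n^'n" assume X: "X \<in> fantope k"
    then have le: "onorm ((*v) X) \<le> 1"
      using psd_spectral_norm_le_1_iff by (auto simp: fantope_def spectral_norm_eq_onorm)
    have "\<bar>X $ i $ j\<bar> \<le> 1" for i j
    proof -
      have "\<bar>X $ i $ j\<bar> \<le> norm (X *v axis j 1)"
        using component_le_norm_cart[of "X *v axis j 1" i]
        by (simp add: matrix_vector_mult_basis column_def)
      also have "\<dots> \<le> onorm ((*v) X) * norm (axis j (1::real) :: real^'n)"
        by (rule onorm[OF matrix_vector_mul_bounded_linear])
      finally show ?thesis using le by simp
    qed
    then have "norm (X $ i) \<le> real CARD('n)" for i
      using norm_le_l1_cart[of "X $ i"] sum_bounded_above[of UNIV "\<lambda>j. \<bar>X $ i $ j\<bar>" 1]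
      by (simp add: order_trans)
    then have "(\<Sum>i\<in>UNIV. norm (X $ i)) \<le> real CARD('n) * real CARD('n)"
      using sum_bounded_above[of UNIV "\<lambda>i. norm (X $ i)" "real CARD('n)"] by simp
    moreover have "norm X \<le> (\<Sum>i\<in>UNIV. norm (X $ i))"
      unfolding norm_vec_def by (rule L2_set_le_sum) simp
    ultimately show "norm X \<le> real CARD('n) * real CARD('n)" by linarith
  qed
  ultimately show ?thesis by (simp add: compact_eq_bounded_closed)
qed

lemma zero_in_fantope: "(0 :: real^'n^'n) \<in> fantope k"
proof -
  have "trace (0 :: real^'n^'n) = 0" "transpose (0 :: real^'n^'n) = 0"
    by (simp_all add: trace_def transpose_def vec_eq_iff)
  then show ?thesis by (simp add: fantope_def psd_matrices_iff transpose_mat)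
qed

text \<open>In an orthonormal basis adapted to the range of \<open>X\<close> and its orthogonal complement, each of the
  \<open>rank X\<close> diagonal entries from the range is at most 1 and the others vanish.\<close>

lemma trace_le_rank:
  fixes X :: "real^'n^'n"
  assumes X: "X \<in> psd_matrices" and le: "mat 1 - X \<in> psd_matrices"
  shows "trace X \<le> real (rank X)"
proof -
  define S where "S = range ((*v) X)"
  have S: "subspace S"
    unfolding S_def by (intro linear_subspace_image matrix_vector_mul_linear subspace_UNIV)
  define R where "R = {y. \<forall>x\<in>S \<union> {0}. orthogonal x y}"
  have S0: "orthogonal x y" if "x \<in> S" "y \<in> {0}" for x y
    using that by (simp add: orthogonal_def)
  obtain BS BT BR where B: "BS \<subseteq> S" "BT \<subseteq> {0}" "BR \<subseteq> R"
    "card BS = dim S" "card BT = dim {0 :: real^'n}" "card BR = dim R"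
    "pairwise orthogonal (BS \<union> BT \<union> BR)" "\<forall>b\<in>BS \<union> BT \<union> BR. norm b = 1"
    "span (BS \<union> BT \<union> BR) = UNIV" "finite (BS \<union> BT \<union> BR)"
    "BS \<inter> BT = {}" "(BS \<union> BT) \<inter> BR = {}" "dim S + dim {0 :: real^'n} + dim R = DIM(real^'n)"
    unfolding R_def by (rule orthonormal_basis_of_decomposition[OF S subspace_single_0 S0])
  have zero: "b \<bullet> (X *v b) = 0" if "b \<in> BT \<union> BR" for b
    using that B(2,3) by (auto simp: R_def S_def orthogonal_def inner_commute)
  have "trace X = (\<Sum>b\<in>BS \<union> BT \<union> BR. b \<bullet> (X *v b))"
    using B(7-10) by (intro trace_orthonormal_basis) auto
  also have "\<dots> = (\<Sum>b\<in>BS. b \<bullet> (X *v b))"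
    using B(10) zero by (intro sum.mono_neutral_right) auto
  also have "\<dots> \<le> (\<Sum>b\<in>BS. 1)"
  proof (rule sum_mono)
    fix b assume "b \<in> BS"
    then have "b \<bullet> b = 1" using B(8) by (simp add: norm_eq_1)
    then show "b \<bullet> (X *v b) \<le> 1" using le psd_complement_iff[OF X] by metis
  qed
  finally show ?thesis using B(4) by (simp add: rank_dim_range S_def)
qed

text \<open>The number \<open>r\<close> of the second alternative is the dimension of the space \<open>R\<close> on which \<open>X\<close> has
  its eigenvalues strictly between 0 and 1. If that space is trivial, then \<open>tr X = dim F\<close> gives only
  \<open>rank X \<le> k\<close>, which fits the same form with \<open>r = 1\<close>, because \<open>B\<close> has an element. That \<open>B\<close> contains
  the identity makes the perturbation preserve the trace.\<close>

lemma fantope_rank_or_perturbation: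
  fixes X :: "real^'n^'n"
  assumes X: "X \<in> fantope k" and B: "finite B" "mat 1 \<in> B"
  obtains (perturbation) D where "D \<noteq> 0" "\<And>M. M \<in> B \<Longrightarrow> M \<bullet> D = 0" "X + D \<in> fantope k" "X - D \<in> fantope k"
  | (rank) r where "r * (r + 1) \<le> 2 * card B" "rank X + 1 \<le> k + r"
proof -
  have psd: "X \<in> psd_matrices" and psd': "mat 1 - X \<in> psd_matrices" and tr: "trace X \<le> real k"
    using X by (auto simp: fantope_def)
  have sym: "transpose X = X" and pos: "\<And>v. 0 \<le> v \<bullet> (X *v v)"
    using psd by (auto simp: psd_matrices_iff)
  define F where "F = {v. X *v v = v}"
  define K where "K = {v. X *v v = 0}"
  define R where "R = {y. \<forall>x\<in>F \<union> K. orthogonal x y}"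
  have F: "subspace F" and K: "subspace K"
    by (auto simp: F_def K_def subspace_def matrix_vector_right_distrib matrix_vector_mult_scaleR)
  have FK: "orthogonal x y" if "x \<in> F" "y \<in> K" for x y
    using symmetric_inner_mult[OF sym, of x y] that by (simp add: F_def K_def orthogonal_def)
  define W where "W = {D :: real^'n^'n. transpose D = D \<and> (\<forall>v\<in>F \<union> K. D *v v = 0)}"
  have W: "subspace W" "dim R * (dim R + 1) \<le> 2 * dim W"
    unfolding W_def R_def by (rule dim_symmetric_vanishing)+
  obtain BF BK BR where B3: "BF \<subseteq> F" "BK \<subseteq> K" "BR \<subseteq> R"
    "card BF = dim F" "card BK = dim K" "card BR = dim R"
    "pairwise orthogonal (BF \<union> BK \<union> BR)" "\<forall>b\<in>BF \<union> BK \<union> BR. norm b = 1"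
    "span (BF \<union> BK \<union> BR) = UNIV" "finite (BF \<union> BK \<union> BR)"
    "BF \<inter> BK = {}" "(BF \<union> BK) \<inter> BR = {}" "dim F + dim K + dim R = DIM(real^'n)"
    unfolding R_def by (rule orthonormal_basis_of_decomposition[OF F K FK])
  have rank_le: "rank X \<le> dim F + dim R"
  proof -
    have "range ((*v) X) \<subseteq> {y \<in> UNIV. \<forall>x\<in>K. orthogonal x y}"
      using symmetric_inner_mult[OF sym] by (auto simp: K_def orthogonal_def)
    then have "rank X \<le> dim {y \<in> UNIV. \<forall>x\<in>K. orthogonal x y}"
      unfolding rank_dim_range by (rule dim_subset)
    moreover have "dim {y \<in> UNIV. \<forall>x\<in>K. orthogonal x y} + dim K = DIM(real^'n)"
      using dim_subspace_orthogonal_to_vectors[OF K subspace_UNIV] by simp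
    ultimately show ?thesis using B3(13) by linarith
  qed
  have "trace X = (\<Sum>b\<in>BF \<union> BK \<union> BR. b \<bullet> (X *v b))"
    using B3(7-10) by (intro trace_orthonormal_basis) auto
  also have "\<dots> = (\<Sum>b\<in>BF. b \<bullet> (X *v b)) + (\<Sum>b\<in>BK. b \<bullet> (X *v b)) + (\<Sum>b\<in>BR. b \<bullet> (X *v b))"
    using B3(10-12) by (simp add: sum.union_disjoint)
  also have "(\<Sum>b\<in>BF. b \<bullet> (X *v b)) = (\<Sum>b\<in>BF. 1)"
    using B3(1,8) by (intro sum.cong) (auto simp: F_def norm_eq_1)
  also have "(\<Sum>b\<in>BK. b \<bullet> (X *v b)) = 0"
    using B3(2) by (intro sum.neutral) (auto simp: K_def)
  finally have trace: "trace X = real (dim F) + (\<Sum>b\<in>BR. b \<bullet> (X *v b))"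
    using B3(4) by simp
  show thesis
  proof (cases "card B < dim W")
    case True
    obtain D where D: "D \<in> W" "D \<noteq> 0" "\<And>M. M \<in> B \<Longrightarrow> M \<bullet> D = 0"
      using subspace_contains_orthogonal_to_few[OF W(1) B(1) True] by blast
    have kerD: "D *v v = 0" if "v \<in> F \<union> K" for v
      using D(1) that by (auto simp: W_def)
    have symD: "transpose D = D" using D(1) by (simp add: W_def)
    \<comment> \<open>\<open>D\<close> vanishes on the kernel \<open>K\<close> of \<open>X\<close> and on the kernel \<open>F\<close> of \<open>1 - X\<close>, so it may be added
      to either of them.\<close>
    obtain e1 where e1: "0 < e1" "\<And>t. \<bar>t\<bar> \<le> e1 \<Longrightarrow> X + t *\<^sub>R D \<in> psd_matrices"
      using psd_perturbation[OF psd symD] kerD by (auto simp: K_def)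
    have "D *v v = 0" if "(mat 1 - X) *v v = 0" for v
      using that kerD[of v] by (simp add: F_def matrix_vector_mult_diff_rdistrib)
    then obtain e2 where e2: "0 < e2" "\<And>t. \<bar>t\<bar> \<le> e2 \<Longrightarrow> (mat 1 - X) + t *\<^sub>R D \<in> psd_matrices"
      using psd_perturbation[OF psd' symD] by blast
    define e where "e = min e1 e2"
    have e: "0 < e" "e \<le> e1" "e \<le> e2" using e1(1) e2(1) by (auto simp: e_def)
    have "trace D = 0" using D(3)[OF B(2)] by (simp add: inner_mat_1_left)
    then have mem: "X + t *\<^sub>R D \<in> fantope k" if "\<bar>t\<bar> \<le> e" for t
    proof -
      have "trace (X + t *\<^sub>R D) = trace X"
        using D(3)[OF B(2)] by (simp flip: inner_mat_1_left add: inner_add_right)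
      moreover have "mat 1 - (X + t *\<^sub>R D) = (mat 1 - X) + (- t) *\<^sub>R D" by simp
      ultimately show ?thesis
        using that e e1(2)[of t] e2(2)[of "- t"] tr by (auto simp: fantope_def diff_diff_eq)
    qed
    show thesis
      using perturbation[of "e *\<^sub>R D"] D(2,3) e mem[of e] mem[of "- e"] by simp
  next
    case False
    show thesis
    proof (cases "BR = {}")
      case True
      then have dims: "dim F \<le> k" "dim R = 0" using trace tr B3(6) by auto
      have "0 < card B" using B by (auto simp: card_gt_0_iff)
      then have "1 * (1 + 1) \<le> 2 * card B" by simp
      moreover have "rank X + 1 \<le> k + 1" using dims rank_le by linarith
      ultimately show thesis by (rule rank)
    next
      case False': False
      have "0 < (\<Sum>b\<in>BR. b \<bullet> (X *v b))"
      proof (rule sum_pos)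
        fix b assume b: "b \<in> BR"
        have "b \<noteq> 0" using B3(8) b by force
        moreover have "orthogonal b b" if "b \<in> K" using B3(3) b that by (auto simp: R_def)
        ultimately have "b \<notin> K" by (auto simp: orthogonal_self)
        then have "b \<bullet> (X *v b) \<noteq> 0" using psd_kernel[OF psd] by (auto simp: K_def)
        then show "0 < b \<bullet> (X *v b)" using pos[of b] by linarith
      qed (use B3(10) False' in auto)
      then have "dim F < k" using trace tr by linarith
      then have "rank X + 1 \<le> k + dim R" using rank_le by linarith
      moreover have "dim R * (dim R + 1) \<le> 2 * card B" using W(2) False by linarith
      ultimately show thesis by (intro rank)
    qed
  qed
qed

lemma le_1_if_mult_Suc_le_4:
  fixes r :: nat
  assumes "r * (r + 1) \<le> 4"
  shows "r \<le> 1"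
proof (rule ccontr)
  assume "\<not> r \<le> 1"
  then have "2 * 3 \<le> r * (r + 1)" by (intro mult_mono) auto
  with assms show False by simp
qed

lemma extreme_point_no_perturbation:
  fixes x d :: "'a::real_vector"
  assumes "x extreme_point_of S" and "x + d \<in> S" and "x - d \<in> S"
  shows "d = 0"
proof (rule ccontr)
  assume "d \<noteq> 0"
  have "x = midpoint (x - d) (x + d)" by (simp add: midpoint_def scaleR_2[symmetric])
  moreover have "x - d \<noteq> x + d"
  proof
    assume "x - d = x + d"
    then have "2 *\<^sub>R d = 0" by (simp add: scaleR_2 algebra_simps)
    with \<open>d \<noteq> 0\<close> show False by simp
  qed
  ultimately have "x \<in> open_segment (x - d) (x + d)"
    by (metis midpoint_in_open_segment)
  with assms show False by (auto simp: extreme_point_of_def)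
qed

lemma fantope_extreme_point_rank:
  fixes X :: "real^'n^'n"
  assumes ext: "X extreme_point_of fantope k"
  shows "rank X \<le> k"
proof -
  have X: "X \<in> fantope k" using ext by (simp add: extreme_point_of_def)
  have fin: "finite {mat 1 :: real^'n^'n}" and mem: "mat 1 \<in> {mat 1 :: real^'n^'n}" by auto
  from X fin mem show ?thesis
  proof (cases rule: fantope_rank_or_perturbation)
    case (perturbation D)
    then show ?thesis using extreme_point_no_perturbation[OF ext] by blast
  next
    case (rank r)
    have "r \<le> 1" using rank(1) by (intro le_1_if_mult_Suc_le_4) simp
    with rank(2) show ?thesis by simp
  qed
qed

lemma convex_hull_fair_pca_domain:
  "convex hull (fair_pca_domain k) = (fantope k :: (real^'n^'n) set)"
proof
  have "fair_pca_domain k \<subseteq> (fantope k :: (real^'n^'n) set)"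
  proof
    fix X :: "real^'n^'n" assume "X \<in> fair_pca_domain k"
    then have "X \<in> psd_matrices" "mat 1 - X \<in> psd_matrices" "rank X \<le> k"
      by (auto simp: fair_pca_domain_def psd_spectral_norm_le_1_iff)
    then show "X \<in> fantope k"
      using trace_le_rank[of X] by (simp add: fantope_def)
  qed
  then show "convex hull (fair_pca_domain k) \<subseteq> (fantope k :: (real^'n^'n) set)"
    by (intro hull_minimal convex_fantope)
  have "{X. X extreme_point_of fantope k} \<subseteq> (fair_pca_domain k :: (real^'n^'n) set)"
  proof safe
    fix X :: "real^'n^'n" assume ext: "X extreme_point_of fantope k"
    then have "X \<in> fantope k" by (simp add: extreme_point_of_def)
    then show "X \<in> fair_pca_domain k"
      using fantope_extreme_point_rank[OF ext]
      by (simp add: fair_pca_domain_def fantope_def psd_spectral_norm_le_1_iff)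
  qed
  then have "convex hull {X. X extreme_point_of fantope k}
      \<subseteq> (convex hull (fair_pca_domain k) :: (real^'n^'n) set)"
    by (rule hull_mono)
  then show "(fantope k :: (real^'n^'n) set) \<subseteq> convex hull (fair_pca_domain k)"
    by (rule ord_eq_le_trans[OF Krein_Milman_Minkowski[OF compact_fantope convex_fantope]])
qed

section \<open>Low-rank optimal solutions\<close>

text \<open>Bounding \<open>z\<close> below by the value 0 of \<open>X = 0\<close>, and above by the maximum of \<open>A 1 \<bullet> X\<close>, loses no
  candidate for an optimum and makes the feasible set compact.\<close>

lemma fair_pca_relaxed_attained:
  fixes A :: "nat \<Rightarrow> real^'n^'n"
  assumes m: "1 \<le> m"
  obtains z X where "optimal_solution (fair_pca_relaxed k m A) (z, X)"
proof -
  have rel: "fair_pca_relaxed k m A = {(z, X). X \<in> fantope k \<and> (\<forall>i\<in>{1..m}. z \<le> A i \<bullet> X)}"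
    by (simp add: fair_pca_relaxed_def convex_hull_fair_pca_domain)
  have "continuous_on (fantope k) (\<lambda>X. A 1 \<bullet> X)" by (intro continuous_intros)
  then obtain X1 where X1: "\<And>X. X \<in> fantope k \<Longrightarrow> A 1 \<bullet> X \<le> A 1 \<bullet> X1"
    using continuous_attains_sup[OF compact_fantope] zero_in_fantope by (metis empty_iff)
  define M where "M = A 1 \<bullet> X1"
  define P where "P = ({0..M} \<times> fantope k) \<inter> (\<Inter>i\<in>{1..m}. {p. fst p \<le> A i \<bullet> snd p})"
  have "closed {p :: real \<times> (real^'n^'n). fst p \<le> A i \<bullet> snd p}" for i
    by (intro closed_Collect_le continuous_intros)
  then have "compact P"
    unfolding P_def by (intro compact_Int_closed compact_Times compact_fantope closed_INT) auto
  moreover have "(0, 0) \<in> P"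
    using X1[OF zero_in_fantope] by (auto simp: P_def M_def zero_in_fantope)
  moreover have "continuous_on P fst" by (intro continuous_intros)
  ultimately obtain p where p: "p \<in> P" "\<And>q. q \<in> P \<Longrightarrow> fst q \<le> fst p"
    using continuous_attains_sup[of P fst] by (metis empty_iff)
  obtain z X where pz: "p = (z, X)" by (cases p)
  have z0: "0 \<le> z" using p(1) by (auto simp: P_def pz)
  have "z' \<le> z" if "(z', X') \<in> fair_pca_relaxed k m A" for z' X'
  proof (cases "0 \<le> z'")
    case True
    have "z' \<le> A 1 \<bullet> X'" "X' \<in> fantope k" using that m by (auto simp: rel)
    then have "z' \<le> M" using X1 by (force simp: M_def)
    then have "(z', X') \<in> P" using that True by (auto simp: P_def rel)
    then show ?thesis using p(2) pz by fastforce
  next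
    case False
    then show ?thesis using z0 by simp
  qed
  then have "optimal_solution (fair_pca_relaxed k m A) (z, X)"
    using p(1) by (auto simp: optimal_solution_def P_def rel pz)
  then show thesis by (rule that)
qed

text \<open>The solution is an extreme point of the set of all optimal \<open>X\<close>, which rules out the
  perturbation alternative of \<open>fantope_rank_or_perturbation\<close>.\<close>

lemma fair_pca_relaxed_low_rank_optimum:
  fixes A :: "nat \<Rightarrow> real^'n^'n"
  assumes m: "1 \<le> m"
  obtains z X r where "optimal_solution (fair_pca_relaxed k m A) (z, X)"
    and "r * (r + 1) \<le> 2 * m" and "rank X + 1 \<le> k + r"
proof -
  have rel: "fair_pca_relaxed k m A = {(z, X). X \<in> fantope k \<and> (\<forall>i\<in>{1..m}. z \<le> A i \<bullet> X)}"
    by (simp add: fair_pca_relaxed_def convex_hull_fair_pca_domain)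
  obtain z X0 where opt0: "optimal_solution (fair_pca_relaxed k m A) (z, X0)"
    using fair_pca_relaxed_attained[OF m] by blast
  then have zmax: "\<And>z' X'. (z', X') \<in> fair_pca_relaxed k m A \<Longrightarrow> z' \<le> z"
    by (auto simp: optimal_solution_def)
  define Opt where "Opt = fantope k \<inter> (\<Inter>i\<in>{1..m}. {X. A i \<bullet> X \<ge> z})"
  have Opt: "X \<in> Opt \<longleftrightarrow> (z, X) \<in> fair_pca_relaxed k m A" for X
    by (auto simp: Opt_def rel)
  have "compact Opt"
    unfolding Opt_def
    by (intro compact_Int_closed compact_fantope closed_INT) (auto intro: closed_halfspace_ge)
  moreover have "convex Opt"
    unfolding Opt_def
    by (intro convex_Int convex_fantope convex_INT) (auto intro: convex_halfspace_ge)
  moreover have "X0 \<in> Opt" using opt0 by (simp add: Opt optimal_solution_def)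
  ultimately obtain X where ext: "X extreme_point_of Opt"
    using Krein_Milman_Minkowski[of Opt] by (metis (no_types) Collect_empty_eq convex_hull_eq_empty empty_iff)
  have XOpt: "X \<in> Opt" using ext by (simp add: extreme_point_of_def)
  have opt: "optimal_solution (fair_pca_relaxed k m A) (z, X)"
    using XOpt zmax by (auto simp: Opt optimal_solution_def)
  \<comment> \<open>Orthogonality of \<open>D\<close> to \<open>B\<close> means that moving along \<open>D\<close> preserves the trace and shifts all
    \<open>A i \<bullet> X\<close> equally. Requiring \<open>A i \<bullet> D = 0\<close> for every \<open>i\<close> would cost one more condition.\<close>
  define B where "B = insert (mat 1) ((\<lambda>i. A i - A 1) ` {2..m})"
  have finB: "finite B" and memB: "mat 1 \<in> B" by (auto simp: B_def)
  have cardB: "card B \<le> m"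
  proof -
    have "card B \<le> Suc (card ((\<lambda>i. A i - A 1) ` {2..m}))"
      unfolding B_def by (rule card_insert_le_m1) auto
    also have "card ((\<lambda>i. A i - A 1) ` {2..m}) \<le> card {2..m}" by (rule card_image_le) simp
    finally show ?thesis using m by simp
  qed
  have "X \<in> fantope k" using XOpt by (simp add: Opt_def)
  then show thesis using finB memB
  proof (cases rule: fantope_rank_or_perturbation)
    case (perturbation D)
    have AD: "A i \<bullet> D = A 1 \<bullet> D" if "i \<in> {1..m}" for i
    proof (cases "i = 1")
      case False
      then have "(A i - A 1) \<bullet> D = 0" using that by (intro perturbation(2)) (auto simp: B_def)
      then show ?thesis by (simp add: inner_diff_left)
    qed simp
    have Xz: "z \<le> A i \<bullet> X" if "i \<in> {1..m}" for i using XOpt that by (auto simp: Opt_def)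
    have "z + A 1 \<bullet> D \<le> A i \<bullet> (X + D)" if "i \<in> {1..m}" for i
      using AD[OF that] Xz[OF that] by (simp only: inner_add_right)
    then have plus: "(z + A 1 \<bullet> D, X + D) \<in> fair_pca_relaxed k m A"
      using perturbation(3) unfolding rel by blast
    have "z - A 1 \<bullet> D \<le> A i \<bullet> (X - D)" if "i \<in> {1..m}" for i
      using AD[OF that] Xz[OF that] by (simp only: inner_diff_right)
    then have minus: "(z - A 1 \<bullet> D, X - D) \<in> fair_pca_relaxed k m A"
      using perturbation(4) unfolding rel by blast
    have "A 1 \<bullet> D = 0" using zmax[OF plus] zmax[OF minus] by linarith
    then have "X + D \<in> Opt" "X - D \<in> Opt" using plus minus by (simp_all add: Opt)
    then show thesis using extreme_point_no_perturbation[OF ext] perturbation(1) by blast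
  next
    case (rank r)
    have "2 * card B \<le> 2 * m" using cardB by simp
    then have "r * (r + 1) \<le> 2 * m" using rank(1) by (rule order_trans[rotated])
    then show thesis using that[OF opt] rank(2) by blast
  qed
qed

theorem corollary2:
  fixes A :: "nat \<Rightarrow> real^'n^'n" and k m :: nat
  assumes "1 \<le> k" and "k \<le> CARD('n)" and "1 \<le> m"
    and "\<forall>i\<in>{1..m}. A i \<in> psd_matrices"
  shows "convex hull (fair_pca_domain k) =
           {X :: real^'n^'n. X \<in> psd_matrices \<and> trace X \<le> real k \<and> spectral_norm X \<le> 1} \<and>
         (\<exists>z X. optimal_solution (fair_pca_relaxed k m A) (z, X) \<and>
           int (rank X) \<le> int k + \<lfloor>sqrt (2 * real m + 1 / 4) - 3 / 2\<rfloor>) \<and>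
         (m \<le> 2 \<longrightarrow>
           (\<exists>v. optimal_value (fair_pca_relaxed k m A) v \<and> optimal_value (fair_pca k m A) v))"
proof (intro conjI impI)
  show "convex hull (fair_pca_domain k) =
           {X :: real^'n^'n. X \<in> psd_matrices \<and> trace X \<le> real k \<and> spectral_norm X \<le> 1}"
    by (simp only: fantope_eq convex_hull_fair_pca_domain)
  obtain z X r where opt: "optimal_solution (fair_pca_relaxed k m A) (z, X)"
    and r: "r * (r + 1) \<le> 2 * m" and rank: "rank X + 1 \<le> k + r"
    using fair_pca_relaxed_low_rank_optimum[OF \<open>1 \<le> m\<close>] by blast
  \<comment> \<open>Completing the square in \<open>r * (r + 1) \<le> 2 * m\<close>.\<close>
  have "real r + 1 / 2 \<le> sqrt (2 * real m + 1 / 4)"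
  proof (rule real_le_rsqrt)
    have "real (r * (r + 1)) \<le> real (2 * m)" using r by (simp only: of_nat_le_iff)
    then show "(real r + 1 / 2)\<^sup>2 \<le> 2 * real m + 1 / 4"
      by (simp add: power2_eq_square algebra_simps)
  qed
  then have "int r - 1 \<le> \<lfloor>sqrt (2 * real m + 1 / 4) - 3 / 2\<rfloor>"
    by (simp add: le_floor_iff)
  with rank have "int (rank X) \<le> int k + \<lfloor>sqrt (2 * real m + 1 / 4) - 3 / 2\<rfloor>"
    by linarith
  with opt show "\<exists>z X. optimal_solution (fair_pca_relaxed k m A) (z, X) \<and>
           int (rank X) \<le> int k + \<lfloor>sqrt (2 * real m + 1 / 4) - 3 / 2\<rfloor>"
    by blast
  assume "m \<le> 2"
  have "r \<le> 1" using r \<open>m \<le> 2\<close> by (intro le_1_if_mult_Suc_le_4) simp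
  then have "rank X \<le> k" using rank by simp
  have X: "X \<in> fantope k" "\<And>i. i \<in> {1..m} \<Longrightarrow> z \<le> A i \<bullet> X"
    and zmax: "\<And>z' X'. (z', X') \<in> fair_pca_relaxed k m A \<Longrightarrow> z' \<le> z"
    using opt by (auto simp: optimal_solution_def fair_pca_relaxed_def convex_hull_fair_pca_domain)
  have "(0, 0) \<in> fair_pca_relaxed k m A"
    by (simp add: fair_pca_relaxed_def convex_hull_fair_pca_domain zero_in_fantope)
  then have "0 \<le> z" by (rule zmax)
  moreover have "X \<in> fair_pca_domain k"
    using X(1) \<open>rank X \<le> k\<close> by (auto simp: fair_pca_domain_def simp flip: fantope_eq)
  ultimately have "(z, X) \<in> fair_pca k m A" using X(2) by (simp add: fair_pca_def)
  moreover have "fair_pca k m A \<subseteq> fair_pca_relaxed k m A"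
    by (auto simp: fair_pca_def fair_pca_relaxed_def hull_inc)
  ultimately have "optimal_solution (fair_pca k m A) (z, X)"
    using opt by (auto simp: optimal_solution_def)
  with opt show "\<exists>v. optimal_value (fair_pca_relaxed k m A) v \<and> optimal_value (fair_pca k m A) v"
    by (auto simp: optimal_value_def)
qed

end
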